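(* Let $\mathscr H$ be a real separable Hilbert space and let $q,t\in\mathbb R$ satisfy $|q|<t$. Then for every $n\in\mathbb N$ the operator $$P_{q,t}^{(n)}=\sum_{\pi\in S_n}q^{\mathrm{inv}(\pi)}\,t^{\mathrm{cinv}(\pi)}\,U_\pi^{(n)}$$ on $\mathscr H_{\mathbb C}^{\otimes n}$ is strictly positive definite, i.e. $\langle \xi,P_{q,t}^{(n)}\xi\rangle_0>0$ for all nonzero $\xi\in\mathscr H_{\mathbb C}^{\otimes n}$. Consequently the sesquilinear form $\langle\eta,\xi\rangle_{q,t}:=\langle\eta,P_{q,t}\,\xi\rangle_0$ ($\eta,\xi\in\mathscr F$) is an inner product on $\mathscr F$. (The $(q,t)$-Fock space $\mathscr F_{q,t}$ is defined as the completion of $\mathscr F$ with respect to the norm induced by $\langle\cdot,\cdot\rangle_{q,t}$.)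
   Context: $\mathscr H_{\mathbb C}$ is the complexification of $\mathscr H$, with inner product extended to be conjugate-linear in the first and linear in the second argument. $\mathscr F=\mathbb C\Omega\oplus\bigoplus_{n\ge1}\mathscr H_{\mathbb C}^{\otimes n}$, with algebraic direct sum and algebraic tensor products, where $\Omega$ is a distinguished unit vector (the vacuum). $\langle\cdot,\cdot\rangle_0$ is the usual full Fock space inner product on $\mathscr F$: $\langle\Omega,\Omega\rangle_0=1$, different tensor degrees are orthogonal, and $\langle g_1\otimes\cdots\otimes g_n,h_1\otimes\cdots\otimes h_n\rangle_0=\prod_{i=1}^n\langle g_i,h_i\rangle$. For $\pi\in S_n$: $\mathrm{inv}(\pi)=|\{(i,j):1\le i<j\le n,\ \pi(i)>\pi(j)\}|$ (inversions) and $\mathrm{cinv}(\pi)=|\{(i,j):1\le i<j\le n,\ \pi(i)<\pi(j)\}|$ (co-inversions); both are $0$ for $n=1$. $U^{(n)}_\pi$ is the unitary operator on $\mathscr H_{\mathbb C}^{\otimes n}$ determined by $U_\pi^{(n)}h_1\otimes\cdots\otimes h_n=h_{\pi(1)}\otimes\cdots\otimes h_{\pi(n)}$. $P_{q,t}=\bigoplus_{n\ge0}P_{q,t}^{(n)}$ with $P_{q,t}^{(0)}$ the identity on $\mathbb C\Omega$. Convention: $0^0=1$. *)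

theory Defs
  imports
    "HOL-Analysis.Analysis"
    "HOL-Library.Poly_Mapping"
    "HOL-Library.Complex_Order"
    "HOL-Combinatorics.Permutations"
begin

text \<open>
  For complex numbers \<open>0 < z\<close> is the order of \<open>Complex_Order\<close>: \<open>z\<close> is real and strictly positive.
\<close>

locale complex_inner_product = vector_space scale
  for scale :: "complex \<Rightarrow> 'v::ab_group_add \<Rightarrow> 'v" +
  fixes ip :: "'v \<Rightarrow> 'v \<Rightarrow> complex"
  assumes ip_add_left: "ip (x + y) z = ip x z + ip y z"
    and ip_scale_left: "ip (scale c x) z = cnj c * ip x z"
    and ip_add_right: "ip x (y + z) = ip x y + ip x z"
    and ip_scale_right: "ip x (scale c z) = c * ip x z"
    and ip_cnj: "ip y x = cnj (ip x y)"
    and ip_pos: "x \<noteq> 0 \<Longrightarrow> 0 < ip x x"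


section \<open>Complexification\<close>

text \<open>The pair \<open>(x, y)\<close> stands for \<open>x + i y\<close>.\<close>

type_synonym 'a complexified = "'a \<times> 'a"

definition cscale :: "complex \<Rightarrow> 'a::real_vector complexified \<Rightarrow> 'a complexified" where
  "cscale c z = (Re c *\<^sub>R fst z - Im c *\<^sub>R snd z, Re c *\<^sub>R snd z + Im c *\<^sub>R fst z)"

definition cinner :: "'a::real_inner complexified \<Rightarrow> 'a complexified \<Rightarrow> complex" where
  "cinner z w = Complex (fst z \<bullet> fst w + snd z \<bullet> snd w) (fst z \<bullet> snd w - snd z \<bullet> fst w)"

lemma complex_inner_product_cinner:
  "complex_inner_product (cscale :: complex \<Rightarrow> 'a::real_inner complexified \<Rightarrow> _) cinner"
proof
  fix x :: "'a complexified"
  assume "x \<noteq> 0"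
  then have "fst x \<noteq> 0 \<or> snd x \<noteq> 0" by (simp add: prod_eq_iff)
  then have "fst x \<bullet> fst x + snd x \<bullet> snd x > 0"
    by (meson add_pos_nonneg add_nonneg_pos inner_ge_zero inner_gt_zero_iff)
  then show "0 < cinner x x"
    by (simp add: cinner_def less_complex_def inner_commute)
qed (auto simp: cscale_def cinner_def prod_eq_iff complex_eq_iff algebra_simps inner_simps
      inner_commute)

global_interpretation cplx: complex_inner_product
  "cscale :: complex \<Rightarrow> 'a::real_inner complexified \<Rightarrow> 'a complexified" cinner
  by (rule complex_inner_product_cinner)


section \<open>The free complex vector space on words\<close>

abbreviation lookup :: "('w \<Rightarrow>\<^sub>0 complex) \<Rightarrow> 'w \<Rightarrow> complex" where
  "lookup \<equiv> Poly_Mapping.lookup"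

abbreviation keys :: "('w \<Rightarrow>\<^sub>0 complex) \<Rightarrow> 'w set" where
  "keys \<equiv> Poly_Mapping.keys"

definition free_scale :: "complex \<Rightarrow> ('w \<Rightarrow>\<^sub>0 complex) \<Rightarrow> ('w \<Rightarrow>\<^sub>0 complex)" where
  "free_scale c p = Poly_Mapping.map ((*) c) p"

lemma lookup_free_scale [simp]: "lookup (free_scale c p) w = c * lookup p w"
  by (simp add: free_scale_def map.rep_eq when_def)

global_interpretation free: vector_space "free_scale :: complex \<Rightarrow> ('w \<Rightarrow>\<^sub>0 complex) \<Rightarrow> _"
  by standard (auto intro!: poly_mapping_eqI simp: lookup_add algebra_simps)

text \<open>\<open>word h\<close> is the basis vector that becomes \<open>h\<^sub>1 \<otimes> \<dots> \<otimes> h\<^sub>n\<close> in the quotient below.\<close>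

abbreviation word :: "'w \<Rightarrow> 'w \<Rightarrow>\<^sub>0 complex" where
  "word h \<equiv> Poly_Mapping.single h 1"

lemma word_expansion:
  assumes "finite S" "keys p \<subseteq> S"
  shows "p = (\<Sum>w\<in>S. free_scale (lookup p w) (word w))"
proof (rule poly_mapping_eqI)
  fix v
  have "lookup (\<Sum>w\<in>S. free_scale (lookup p w) (word w)) v
      = (\<Sum>w\<in>S. if w = v then lookup p w else 0)"
    by (auto simp: lookup_sum lookup_single when_def intro!: sum.cong)
  also have "\<dots> = lookup p v"
    using assms by (auto simp: in_keys_iff subset_iff)
  finally show "lookup p v = lookup (\<Sum>w\<in>S. free_scale (lookup p w) (word w)) v" by simp
qed

inductive_set multilinear_relations :: "('a::real_vector complexified list \<Rightarrow>\<^sub>0 complex) set" where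
  additive: "j < length h \<Longrightarrow>
     word (h[j := x + y]) - word (h[j := x]) - word (h[j := y]) \<in> multilinear_relations"
| homogeneous: "j < length h \<Longrightarrow>
     word (h[j := cscale c x]) - free_scale c (word (h[j := x])) \<in> multilinear_relations"


section \<open>The algebraic Fock space\<close>

text \<open>
  Dividing the free vector space on words of length \<open>n\<close> by multilinearity gives the algebraic tensor
  power of degree \<open>n\<close>.  Since the relations are homogeneous in the length, doing so for
  words of all lengths at once gives the algebraic direct sum of all tensor powers; the empty word
  carries no relation and gives the vacuum.
\<close>

definition fock_rel ::
    "('a::real_inner complexified list \<Rightarrow>\<^sub>0 complex) \<Rightarrow> ('a complexified list \<Rightarrow>\<^sub>0 complex) \<Rightarrow> bool" where
  "fock_rel p r \<longleftrightarrow> p - r \<in> free.span multilinear_relations"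

lemma fock_rel_minus: "fock_rel p r \<Longrightarrow> fock_rel p' r' \<Longrightarrow> fock_rel (p - p') (r - r')"
  unfolding fock_rel_def using free.span_diff[of "p - r" _ "p' - r'"] by (simp add: algebra_simps)

lemma fock_rel_add: "fock_rel p r \<Longrightarrow> fock_rel p' r' \<Longrightarrow> fock_rel (p + p') (r + r')"
  unfolding fock_rel_def using free.span_add[of "p - r" _ "p' - r'"] by (simp add: algebra_simps)

lemma fock_rel_scale: "fock_rel p r \<Longrightarrow> fock_rel (free_scale c p) (free_scale c r)"
  unfolding fock_rel_def using free.span_scale[of "p - r" _ c]
  by (simp add: free.scale_right_diff_distrib)

lemma fock_rel_refl [simp]: "fock_rel p p"
  by (simp add: fock_rel_def free.span_zero)

lemma equivp_fock_rel: "equivp fock_rel"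
proof (rule equivpI)
  show "symp fock_rel"
    by (rule sympI) (metis fock_rel_def free.span_neg minus_diff_eq)
  show "transp fock_rel"
    by (rule transpI) (metis (no_types, lifting) diff_add_cancel add_diff_eq fock_rel_def free.span_add)
qed (simp add: reflpI)

quotient_type (overloaded) 'a fock = "'a::real_inner complexified list \<Rightarrow>\<^sub>0 complex" / fock_rel
  by (rule equivp_fock_rel)

instantiation fock :: (real_inner) ab_group_add
begin

lift_definition zero_fock :: "'a fock" is 0 .
lift_definition plus_fock :: "'a fock \<Rightarrow> 'a fock \<Rightarrow> 'a fock" is "(+)"
  by (rule fock_rel_add)
lift_definition minus_fock :: "'a fock \<Rightarrow> 'a fock \<Rightarrow> 'a fock" is "(-)"
  by (rule fock_rel_minus)
lift_definition uminus_fock :: "'a fock \<Rightarrow> 'a fock" is uminus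
  using fock_rel_minus[of 0 0] by simp

instance
  by standard (transfer, simp add: algebra_simps)+

end

lift_definition fock_scale :: "complex \<Rightarrow> 'a::real_inner fock \<Rightarrow> 'a fock" is free_scale
  by (rule fock_rel_scale)

global_interpretation fock: vector_space "fock_scale :: complex \<Rightarrow> 'a::real_inner fock \<Rightarrow> _"
  by standard (transfer, simp add: algebra_simps)+

lift_definition tensor :: "'a::real_inner complexified list \<Rightarrow> 'a fock" is word .

definition tensor_power :: "nat \<Rightarrow> 'a::real_inner fock set" where
  "tensor_power n = fock.span {tensor h | h. length h = n}"

lemma tensor_add: "j < length h \<Longrightarrow> tensor (h[j := x + y]) = tensor (h[j := x]) + tensor (h[j := y])"
  by transfer
    (auto simp: fock_rel_def diff_diff_eq[symmetric] intro!: free.span_base multilinear_relations.additive)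

lemma tensor_scale: "j < length h \<Longrightarrow> tensor (h[j := cscale c x]) = fock_scale c (tensor (h[j := x]))"
  by transfer (auto simp: fock_rel_def intro!: free.span_base multilinear_relations.homogeneous)


section \<open>The full Fock space inner product\<close>

definition word_inner :: "'a::real_inner complexified list \<Rightarrow> 'a complexified list \<Rightarrow> complex" where
  "word_inner g h = (if length g = length h then \<Prod>i<length g. cinner (g ! i) (h ! i) else 0)"

definition free_inner ::
    "('a::real_inner complexified list \<Rightarrow>\<^sub>0 complex) \<Rightarrow> ('a complexified list \<Rightarrow>\<^sub>0 complex) \<Rightarrow> complex" where
  "free_inner p r =
     (\<Sum>g\<in>keys p. \<Sum>h\<in>keys r. cnj (lookup p g) * lookup r h * word_inner g h)"

lemma free_inner_superset:
  assumes "finite S" "keys p \<subseteq> S" "finite T" "keys r \<subseteq> T"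
  shows "free_inner p r = (\<Sum>g\<in>S. \<Sum>h\<in>T. cnj (lookup p g) * lookup r h * word_inner g h)"
proof -
  have "(\<Sum>h\<in>keys r. cnj (lookup p g) * lookup r h * word_inner g h)
      = (\<Sum>h\<in>T. cnj (lookup p g) * lookup r h * word_inner g h)" for g
    using assms by (intro sum.mono_neutral_left) (auto simp: in_keys_iff)
  moreover have "(\<Sum>g\<in>keys p. \<Sum>h\<in>T. cnj (lookup p g) * lookup r h * word_inner g h)
      = (\<Sum>g\<in>S. \<Sum>h\<in>T. cnj (lookup p g) * lookup r h * word_inner g h)"
    using assms by (intro sum.mono_neutral_left) (auto simp: in_keys_iff)
  ultimately show ?thesis by (simp add: free_inner_def)
qed

lemma free_inner_add_right: "free_inner p (r + s) = free_inner p r + free_inner p s"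
proof -
  let ?T = "keys r \<union> keys s"
  have "keys (r + s) \<subseteq> ?T" by (rule keys_add)
  then show ?thesis
    by (simp add: free_inner_superset[of "keys p" _ ?T] lookup_add algebra_simps sum.distrib)
qed

lemma free_inner_scale_right: "free_inner p (free_scale c r) = c * free_inner p r"
proof -
  have "keys (free_scale c r) \<subseteq> keys r" by (auto simp: in_keys_iff)
  then show ?thesis
    by (simp add: free_inner_superset[of "keys p" _ "keys r"] sum_distrib_left mult_ac)
qed

lemma word_inner_cnj: "word_inner h g = cnj (word_inner g h)"
  by (auto simp: word_inner_def intro!: prod.cong cplx.ip_cnj)

lemma free_inner_cnj: "free_inner r p = cnj (free_inner p r)"
proof -
  have "free_inner r p =
      (\<Sum>g\<in>keys p. \<Sum>h\<in>keys r. cnj (lookup r h) * lookup p g * word_inner h g)"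
    unfolding free_inner_def by (rule sum.swap)
  also have "\<dots> = cnj (free_inner p r)"
    unfolding free_inner_def cnj_sum
    by (intro sum.cong refl, subst word_inner_cnj) (simp add: mult_ac)
  finally show ?thesis .
qed

lemma free_inner_diff_right: "free_inner p (r - s) = free_inner p r - free_inner p s"
  using free_inner_add_right[of p "r - s" s] by (simp add: algebra_simps)

lemma free_inner_word: "free_inner (word g) (word h) = word_inner g h"
  by (simp add: free_inner_def)

lemma word_inner_add:
  assumes "j < length h"
  shows "word_inner g (h[j := x + y]) = word_inner g (h[j := x]) + word_inner g (h[j := y])"
proof (cases "length g = length h")
  case True
  have "(\<Prod>i<length g. cinner (g ! i) (h[j := z] ! i)) =
      cinner (g ! j) z * (\<Prod>i\<in>{..<length g} - {j}. cinner (g ! i) (h ! i))" for z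
    using assms True by (subst prod.remove[of _ j]) (auto intro!: prod.cong)
  then show ?thesis using True by (simp add: word_inner_def cplx.ip_add_right algebra_simps)
qed (simp add: word_inner_def)

lemma word_inner_scale:
  assumes "j < length h"
  shows "word_inner g (h[j := cscale c x]) = c * word_inner g (h[j := x])"
proof (cases "length g = length h")
  case True
  have "(\<Prod>i<length g. cinner (g ! i) (h[j := z] ! i)) =
      cinner (g ! j) z * (\<Prod>i\<in>{..<length g} - {j}. cinner (g ! i) (h ! i))" for z
    using assms True by (subst prod.remove[of _ j]) (auto intro!: prod.cong)
  then show ?thesis using True by (simp add: word_inner_def cplx.ip_scale_right algebra_simps)
qed (simp add: word_inner_def)

lemma free_inner_relation:
  assumes "r \<in> free.span multilinear_relations"
  shows "free_inner p r = 0"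
  using assms
proof (induction rule: free.span_induct_alt)
  case base
  show ?case by (simp add: free_inner_def)
next
  case (step c x y)
  have *: "free_inner p r = (\<Sum>g\<in>keys p. cnj (lookup p g) * free_inner (word g) r)" for r
    by (simp add: free_inner_def sum_distrib_left mult_ac)
  have "free_inner (word g) x = 0" for g
    using step(1) by cases
      (simp_all add: free_inner_diff_right free_inner_scale_right free_inner_word
        word_inner_add word_inner_scale)
  then have "free_inner p x = 0" by (subst *) simp
  then show ?case using step by (simp add: free_inner_add_right free_inner_scale_right)
qed

lift_definition fock_inner :: "'a::real_inner fock \<Rightarrow> 'a fock \<Rightarrow> complex" is free_inner
proof -
  fix p p' r r' :: "'a complexified list \<Rightarrow>\<^sub>0 complex"
  assume "fock_rel p p'" "fock_rel r r'"
  then have r: "free_inner s r = free_inner s r'" and p: "free_inner s p = free_inner s p'" for s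
    using free_inner_relation[of "r - r'" s] free_inner_relation[of "p - p'" s]
    by (auto simp: fock_rel_def free_inner_diff_right)
  show "free_inner p r = free_inner p' r'"
    using r[of p] p[of r'] free_inner_cnj[of p r'] free_inner_cnj[of p' r'] by simp
qed

lemma fock_inner_tensor:
  "fock_inner (tensor g) (tensor h) =
     (if length g = length h then \<Prod>i<length g. cinner (g ! i) (h ! i) else 0)"
  by transfer (simp add: free_inner_word word_inner_def)


section \<open>Permutation operators\<close>

text \<open>
  Positions are counted from \<open>0\<close>, so permutations of \<open>{..<n}\<close> replace those of
  \<open>{1..n}\<close>.  The operator \<open>perm_op n \<pi>\<close> is extended by \<open>0\<close> to the tensor powers
  of degree other than \<open>n\<close>.  It is \<open>0\<close> if \<open>\<pi>\<close> does not permute \<open>{..<n}\<close>, since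
  rearranging factors along such a function is not multilinear.
\<close>

definition free_perm :: "nat \<Rightarrow> (nat \<Rightarrow> nat) \<Rightarrow>
    ('a::real_inner complexified list \<Rightarrow>\<^sub>0 complex) \<Rightarrow> ('a complexified list \<Rightarrow>\<^sub>0 complex)" where
  "free_perm n \<pi> p = (\<Sum>h\<in>keys p. free_scale (lookup p h)
     (if length h = n \<and> \<pi> permutes {..<n} then word (permute_list \<pi> h) else 0))"

lemma free_perm_superset:
  assumes "finite S" "keys p \<subseteq> S"
  shows "free_perm n \<pi> p = (\<Sum>h\<in>S. free_scale (lookup p h)
     (if length h = n \<and> \<pi> permutes {..<n} then word (permute_list \<pi> h) else 0))"
  unfolding free_perm_def using assms
  by (intro sum.mono_neutral_left) (auto simp: in_keys_iff)

lemma free_perm_add: "free_perm n \<pi> (p + r) = free_perm n \<pi> p + free_perm n \<pi> r"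
proof -
  let ?T = "keys p \<union> keys r"
  have "keys (p + r) \<subseteq> ?T" by (rule keys_add)
  then show ?thesis
    by (simp add: free_perm_superset[of ?T] lookup_add free.scale_left_distrib sum.distrib)
qed

lemma free_perm_scale: "free_perm n \<pi> (free_scale c p) = free_scale c (free_perm n \<pi> p)"
proof -
  have "keys (free_scale c p) \<subseteq> keys p" by (auto simp: in_keys_iff)
  then show ?thesis
    by (simp add: free_perm_superset[of "keys p"] free.scale_sum_right del: if_split)
qed

lemma free_perm_diff: "free_perm n \<pi> (p - r) = free_perm n \<pi> p - free_perm n \<pi> r"
  using free_perm_add[of n \<pi> "p - r" r] by (simp add: algebra_simps)

lemma free_perm_word:
  "free_perm n \<pi> (word h) = (if length h = n \<and> \<pi> permutes {..<n} then word (permute_list \<pi> h) else 0)"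
  by (subst free_perm_superset[of "{h}"]) simp_all

lemma permute_list_update:
  assumes "\<pi> permutes {..<length h}" "j < length h"
  shows "\<exists>k<length h. \<forall>x. permute_list \<pi> (h[j := x]) = (permute_list \<pi> h)[k := x]"
proof -
  from assms obtain k where k: "\<pi> k = j" by (metis permutes_surj surjD)
  have "k < length h" using assms k by (metis lessThan_iff permutes_in_image)
  moreover have "permute_list \<pi> (h[j := x]) = (permute_list \<pi> h)[k := x]" for x
  proof (rule nth_equalityI)
    fix i assume "i < length (permute_list \<pi> (h[j := x]))"
    then have i: "i < length h" by simp
    have "\<pi> i < length h" using assms(1) i by (metis lessThan_iff permutes_in_image)
    moreover have "\<pi> i = j \<longleftrightarrow> i = k" using k assms(1) by (metis permutes_inj injD)
    ultimately show "permute_list \<pi> (h[j := x]) ! i = (permute_list \<pi> h)[k := x] ! i"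
      using i assms(1) by (auto simp: permute_list_nth nth_list_update)
  qed simp
  ultimately show ?thesis by blast
qed

lemma free_perm_relation:
  assumes "p \<in> free.span multilinear_relations"
  shows "free_perm n \<pi> p \<in> free.span multilinear_relations"
  using assms
proof (induction rule: free.span_induct_alt)
  case base
  show ?case by (simp add: free_perm_def free.span_zero)
next
  case (step c x y)
  have "free_perm n \<pi> x \<in> free.span multilinear_relations"
    using step(1)
  proof cases
    case (additive j h a b)
    show ?thesis
    proof (cases "length h = n \<and> \<pi> permutes {..<n}")
      case True
      then obtain k where "k < length h"
        "\<And>x. permute_list \<pi> (h[j := x]) = (permute_list \<pi> h)[k := x]"
        using permute_list_update additive(2) by metis
      then show ?thesis using True additive(1)
        by (auto simp: free_perm_diff free_perm_word
            intro!: free.span_base multilinear_relations.additive)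
    qed (auto simp: additive(1) free_perm_diff free_perm_word free.span_zero)
  next
    case (homogeneous j h a b)
    show ?thesis
    proof (cases "length h = n \<and> \<pi> permutes {..<n}")
      case True
      then obtain k where "k < length h"
        "\<And>x. permute_list \<pi> (h[j := x]) = (permute_list \<pi> h)[k := x]"
        using permute_list_update homogeneous(2) by metis
      then show ?thesis using True homogeneous(1)
        by (auto simp: free_perm_diff free_perm_scale free_perm_word
            intro!: free.span_base multilinear_relations.homogeneous)
    qed (auto simp: homogeneous(1) free_perm_diff free_perm_scale free_perm_word free.span_zero)
  qed
  then show ?case using step
    by (simp add: free_perm_add free_perm_scale free.span_add free.span_scale)
qed

lift_definition perm_op :: "nat \<Rightarrow> (nat \<Rightarrow> nat) \<Rightarrow> 'a::real_inner fock \<Rightarrow> 'a fock" is free_perm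
  by (metis fock_rel_def free_perm_diff free_perm_relation)

lemma perm_op_tensor:
  assumes "\<pi> permutes {..<n}"
  shows "perm_op n \<pi> (tensor h) = (if length h = n then tensor (permute_list \<pi> h) else 0)"
  using assms by transfer (simp add: free_perm_word)

lemma perm_op_add: "perm_op n \<pi> (\<xi> + \<eta>) = perm_op n \<pi> \<xi> + perm_op n \<pi> \<eta>"
  by transfer (simp add: free_perm_add)

lemma perm_op_scale: "perm_op n \<pi> (fock_scale c \<xi>) = fock_scale c (perm_op n \<pi> \<xi>)"
  by transfer (simp add: free_perm_scale)


section \<open>The (q,t)-deformed form\<close>

definition inversions :: "nat \<Rightarrow> (nat \<Rightarrow> nat) \<Rightarrow> nat" where
  "inversions n \<pi> = card {(i, j). i < j \<and> j < n \<and> \<pi> i > \<pi> j}"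

definition coinversions :: "nat \<Rightarrow> (nat \<Rightarrow> nat) \<Rightarrow> nat" where
  "coinversions n \<pi> = card {(i, j). i < j \<and> j < n \<and> \<pi> i < \<pi> j}"

definition qt_op_deg :: "real \<Rightarrow> real \<Rightarrow> nat \<Rightarrow> 'a::real_inner fock \<Rightarrow> 'a fock" where
  "qt_op_deg q t n \<xi> = (\<Sum>\<pi> | \<pi> permutes {..<n}.
     fock_scale (complex_of_real (q ^ inversions n \<pi> * t ^ coinversions n \<pi>)) (perm_op n \<pi> \<xi>))"

text \<open>
  Since \<open>qt_op_deg q t n\<close> vanishes on all tensor powers of degree other than \<open>n\<close>,
  the direct sum of these operators is the following sum, which has only finitely many nonzero terms.
\<close>

definition qt_op :: "real \<Rightarrow> real \<Rightarrow> 'a::real_inner fock \<Rightarrow> 'a fock" where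
  "qt_op q t \<xi> = Sum_any (\<lambda>n. qt_op_deg q t n \<xi>)"

definition qt_inner :: "real \<Rightarrow> real \<Rightarrow> 'a::real_inner fock \<Rightarrow> 'a fock \<Rightarrow> complex" where
  "qt_inner q t \<eta> \<xi> = fock_inner \<eta> (qt_op q t \<xi>)"

lemma qt_op_deg_tensor_other: "length h \<noteq> n \<Longrightarrow> qt_op_deg q t n (tensor h) = 0"
  by (simp add: qt_op_deg_def perm_op_tensor)

lemma qt_op_deg_add: "qt_op_deg q t n (\<xi> + \<eta>) = qt_op_deg q t n \<xi> + qt_op_deg q t n \<eta>"
  by (simp add: qt_op_deg_def perm_op_add fock.scale_right_distrib sum.distrib)

lemma qt_op_deg_scale: "qt_op_deg q t n (fock_scale c \<xi>) = fock_scale c (qt_op_deg q t n \<xi>)"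
  by (simp add: qt_op_deg_def perm_op_scale fock.scale_sum_right mult.commute)

lemma qt_op_deg_zero [simp]: "qt_op_deg q t n 0 = 0"
  using qt_op_deg_add[of q t n 0 0] by simp

lemma qt_op_deg_tensor_power:
  assumes "\<xi> \<in> tensor_power n"
  shows "qt_op_deg q t n \<xi> \<in> tensor_power n"
  using assms unfolding tensor_power_def
proof (induction rule: fock.span_induct_alt)
  case base
  show ?case by (simp add: fock.span_zero)
next
  case (step c \<xi> \<eta>)
  then obtain h where h: "\<xi> = tensor h" "length h = n" by auto
  have "qt_op_deg q t n \<xi> \<in> fock.span {tensor h | h. length h = n}"
    unfolding qt_op_deg_def
    by (rule fock.span_sum, rule fock.span_scale, rule fock.span_base)
      (use h in \<open>auto simp: perm_op_tensor intro!: exI[of _ "permute_list _ h"]\<close>)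
  then show ?case using step
    by (simp add: qt_op_deg_add qt_op_deg_scale fock.span_add fock.span_scale)
qed

lemma qt_op_deg_other:
  assumes "\<xi> \<in> tensor_power m" "m \<noteq> n"
  shows "qt_op_deg q t n \<xi> = 0"
  using assms(1) unfolding tensor_power_def
proof (induction rule: fock.span_induct_alt)
  case (step c \<xi> \<eta>)
  then show ?case using assms(2)
    by (auto simp: qt_op_deg_add qt_op_deg_scale qt_op_deg_tensor_other)
qed simp

lemma qt_op_tensor_power:
  assumes "\<xi> \<in> tensor_power n"
  shows "qt_op q t \<xi> = qt_op_deg q t n \<xi>"
proof -
  have "Sum_any (\<lambda>m. qt_op_deg q t m \<xi>) = (\<Sum>m\<in>{n}. qt_op_deg q t m \<xi>)"
    by (rule Sum_any.expand_superset) (use qt_op_deg_other[OF assms] in \<open>force+\<close>)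
  then show ?thesis by (simp add: qt_op_def)
qed

lemma qt_op_deg_0:
  assumes "\<xi> \<in> tensor_power 0"
  shows "qt_op_deg q t 0 \<xi> = \<xi>"
  using assms unfolding tensor_power_def
proof (induction rule: fock.span_induct_alt)
  case base
  show ?case by simp
next
  case (step c \<xi> \<eta>)
  have "{\<pi>. \<pi> permutes {..<0::nat}} = {id}" by auto
  then have "qt_op_deg q t 0 (tensor []) = (tensor [] :: 'a fock)"
    unfolding qt_op_deg_def
    by (simp add: perm_op_tensor[of id 0] inversions_def coinversions_def permutes_id)
  then show ?case using step by (auto simp: qt_op_deg_add qt_op_deg_scale)
qed

lemma fock_span_tensor: "fock.span (range tensor) = (UNIV :: 'a::real_inner fock set)"
proof -
  have *: "abs_fock (\<Sum>w\<in>S. free_scale (c w) (word w)) = (\<Sum>w\<in>S. fock_scale (c w) (tensor w))"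
    if "finite S" for S and c :: "'a complexified list \<Rightarrow> complex"
    using that
    by induction (simp_all add: zero_fock_def plus_fock.abs_eq[symmetric]
        fock_scale.abs_eq[symmetric] tensor.abs_eq)
  have "\<xi> \<in> fock.span (range tensor)" for \<xi> :: "'a fock"
  proof -
    obtain p where p: "\<xi> = abs_fock p" by (metis Quotient3_abs_rep Quotient3_fock)
    have "p = (\<Sum>w\<in>keys p. free_scale (lookup p w) (word w))"
      by (rule word_expansion) auto
    from arg_cong[OF this, of abs_fock]
    have "\<xi> = (\<Sum>w\<in>keys p. fock_scale (lookup p w) (tensor w))"
      unfolding p *[OF finite_keys] .
    then show ?thesis
      by (auto intro!: fock.span_sum fock.span_scale intro: fock.span_base)
  qed
  then show ?thesis by auto
qed

lemma finite_qt_op_deg: "finite {n. qt_op_deg q t n \<xi> \<noteq> 0}"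
proof -
  have "\<xi> \<in> fock.span (range tensor)" by (simp add: fock_span_tensor)
  then show ?thesis
  proof (induction rule: fock.span_induct_alt)
    case base
    show ?case by simp
  next
    case (step c \<xi> \<eta>)
    then obtain h where "\<xi> = tensor h" by auto
    then have "{n. qt_op_deg q t n (fock_scale c \<xi> + \<eta>) \<noteq> 0}
        \<subseteq> insert (length h) {n. qt_op_deg q t n \<eta> \<noteq> 0}"
      by (auto simp: qt_op_deg_add qt_op_deg_scale qt_op_deg_tensor_other)
    then show ?case using step by (meson finite_insert finite_subset)
  qed
qed

end

theory Submission
  imports Defs
begin

text \<open>
  The weight \<open>q\<^bsup>inv(\<pi>)\<^esup> t\<^bsup>cinv(\<pi>)\<^esup>\<close> of \<open>\<pi> = \<tau> \<sigma>\<^sup>-\<^sup>1\<close> is the product, over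
  all pairs of positions, of \<open>t\<close> or \<open>q\<close> according to whether \<open>\<sigma>\<close> and \<open>\<tau>\<close> order the
  pair alike or not.  So it is the restriction to inversion sets of the kernel on subsets of the set
  of pairs that is the tensor product of the matrices with rows \<open>(t, q)\<close> and \<open>(q, t)\<close>, which
  have the positive eigenvalues \<open>t + q\<close> and \<open>t - q\<close>.  Diagonalising this kernel by the
  characters \<open>\<chi>\<^sub>S\<close> of the group of subsets, and averaging over \<open>\<sigma>\<close>, gives
  \<open>n! \<langle>\<eta>, P \<xi>\<rangle> = \<Sum>\<^sub>S c\<^sub>S \<langle>W\<^sub>S \<eta>, W\<^sub>S \<xi>\<rangle>\<close> with
  \<open>W\<^sub>S = \<Sum>\<^sub>\<sigma> \<chi>\<^sub>S(\<sigma>) U\<^sub>\<sigma>\<close> and \<open>c\<^sub>S > 0\<close>.  The form is strictly positive because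
  \<open>\<Sum>\<^sub>S W\<^sub>S\<close> is a nonzero multiple of the identity: only the identity permutation has no
  inversions.
\<close>

section \<open>The full Fock space inner product is positive definite\<close>

lemma fock_inner_add_right: "fock_inner \<eta> (\<xi> + \<zeta>) = fock_inner \<eta> \<xi> + fock_inner \<eta> \<zeta>"
  by transfer (rule free_inner_add_right)

lemma fock_inner_scale_right: "fock_inner \<eta> (fock_scale c \<xi>) = c * fock_inner \<eta> \<xi>"
  by transfer (rule free_inner_scale_right)

lemma fock_inner_cnj: "fock_inner \<xi> \<eta> = cnj (fock_inner \<eta> \<xi>)"
  by transfer (rule free_inner_cnj)

lemma fock_inner_add_left: "fock_inner (\<xi> + \<zeta>) \<eta> = fock_inner \<xi> \<eta> + fock_inner \<zeta> \<eta>"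
  by (metis fock_inner_cnj fock_inner_add_right complex_cnj_add)

lemma fock_inner_scale_left: "fock_inner (fock_scale c \<xi>) \<eta> = cnj c * fock_inner \<xi> \<eta>"
  by (metis fock_inner_cnj fock_inner_scale_right complex_cnj_mult)

lemma fock_inner_zero_right [simp]: "fock_inner \<eta> 0 = 0"
  using fock_inner_add_right[of \<eta> 0 0] by simp

lemma fock_inner_zero_left [simp]: "fock_inner 0 \<eta> = 0"
  using fock_inner_add_left[of 0 0 \<eta>] by simp

lemma fock_inner_sum_right: "fock_inner \<eta> (sum f A) = (\<Sum>a\<in>A. fock_inner \<eta> (f a))"
  by (induction A rule: infinite_finite_induct) (simp_all add: fock_inner_add_right)

lemma fock_inner_sum_left: "fock_inner (sum f A) \<eta> = (\<Sum>a\<in>A. fock_inner (f a) \<eta>)"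
  by (induction A rule: infinite_finite_induct) (simp_all add: fock_inner_add_left)

section \<open>Rewriting vectors in words over orthogonal vectors\<close>

text \<open>Multilinear expansion from left to right: \<open>u\<close> holds the slots already
  filled from \<open>X\<close>, so the induction on \<open>v\<close> keeps \<open>u\<close>
  arbitrary.\<close>

lemma tensor_mem_span_words:
  assumes "set u \<subseteq> X" "set v \<subseteq> cplx.span X"
  shows "tensor (u @ v) \<in> fock.span (tensor ` lists X)"
  using assms
proof (induction v arbitrary: u)
  case Nil
  then show ?case by (auto intro!: fock.span_base)
next
  case (Cons a v)
  have "a \<in> cplx.span X" using Cons.prems by simp
  then show ?case
  proof (induction rule: cplx.span_induct_alt)
    case base
    have "tensor (u @ 0 # v) = fock_scale 0 (tensor (u @ 0 # v))"
      using tensor_scale[of "length u" "u @ 0 # v" 0 0] by simp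
    then show ?case by (simp add: fock.span_zero)
  next
    case (step c x y)
    have "tensor (u @ (cscale c x + y) # v) = fock_scale c (tensor (u @ x # v)) + tensor (u @ y # v)"
      using tensor_add[of "length u" "u @ 0 # v" "cscale c x" y]
        tensor_scale[of "length u" "u @ 0 # v" c x] by simp
    moreover have "tensor (u @ x # v) \<in> fock.span (tensor ` lists X)"
      using Cons.IH[of "u @ [x]"] Cons.prems step(1) by simp
    ultimately show ?case using step(2) by (simp add: fock.span_add fock.span_scale)
  qed
qed

text \<open>Split \<open>(x, y)\<close> into x plus i times y. This lets a real orthogonal basis
  serve the complexification.\<close>

lemma complexified_span_real:
  fixes C :: "'a::real_inner set"
  assumes "x \<in> span C" "y \<in> span C"
  shows "(x, y) \<in> cplx.span ((\<lambda>c. (c, 0)) ` C)"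
proof -
  let ?X = "(\<lambda>c. (c, 0)) ` C :: 'a complexified set"
  have real: "(z, 0) \<in> cplx.span ?X" if "z \<in> span C" for z
    using that
  proof (induction rule: span_induct_alt)
    case base
    show ?case using cplx.span_zero[of ?X] by (simp add: zero_prod_def)
  next
    case (step c z w)
    have "(c *\<^sub>R z + w, 0) = cscale (of_real c) (z, 0) + (w, 0)"
      by (simp add: cscale_def)
    then show ?case using step by (auto intro!: cplx.span_add cplx.span_scale intro: cplx.span_base)
  qed
  have "(x, y) = (x, 0) + cscale \<i> (y, 0)" by (simp add: cscale_def)
  then show ?thesis using assms real by (metis cplx.span_add cplx.span_scale)
qed

text \<open>Only finitely many words occur in \<xi>, so Gram-Schmidt applies to the finite set of
  real and imaginary parts of their letters.\<close>

lemma fock_span_orthogonal_words: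
  fixes \<xi> :: "'a::real_inner fock"
  obtains X :: "'a complexified set" where
    "\<xi> \<in> fock.span (tensor ` lists X)" "0 \<notin> X" "pairwise (\<lambda>x y. cinner x y = 0) X"
proof -
  have "\<exists>B. finite B \<and> \<xi> \<in> fock.span (tensor ` lists (B \<times> B))"
    using UNIV_I[of \<xi>] unfolding fock_span_tensor[symmetric]
  proof (induction rule: fock.span_induct_alt)
    case base
    show ?case by (auto intro: fock.span_zero)
  next
    case (step c \<xi> \<eta>)
    then obtain B h where B: "finite B" "\<eta> \<in> fock.span (tensor ` lists (B \<times> B))"
      and h: "\<xi> = tensor h" by auto
    let ?B = "B \<union> fst ` set h \<union> snd ` set h"
    have "h \<in> lists (?B \<times> ?B)" by force
    then have "\<xi> \<in> fock.span (tensor ` lists (?B \<times> ?B))"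
      using h by (auto intro!: fock.span_base)
    moreover have "\<eta> \<in> fock.span (tensor ` lists (?B \<times> ?B))"
      using B(2) by (rule subsetD[OF fock.span_mono, rotated]) (intro image_mono lists_mono, auto)
    ultimately show ?case using B(1)
      by (intro exI[of _ ?B]) (auto intro!: fock.span_add fock.span_scale)
  qed
  then obtain B where B: "finite B" "\<xi> \<in> fock.span (tensor ` lists (B \<times> B))" by blast
  obtain C where C: "span C = span B" "pairwise orthogonal C"
    using basis_orthogonal[OF B(1)] by blast
  \<comment> \<open>Dropping 0 keeps the span and gives every word over \<open>?X\<close> positive
    norm.\<close>
  let ?X = "(\<lambda>c. (c, 0)) ` (C - {0}) :: 'a complexified set"
  have "B \<times> B \<subseteq> cplx.span ?X"
    using complexified_span_real[of _ "C - {0}"] C(1) by (auto intro: span_base)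
  then have "tensor h \<in> fock.span (tensor ` lists ?X)" if "h \<in> lists (B \<times> B)" for h
    using tensor_mem_span_words[of "[]" ?X h] that by auto
  then have "fock.span (tensor ` lists (B \<times> B)) \<subseteq> fock.span (tensor ` lists ?X)"
    by (intro fock.span_minimal) auto
  then have "\<xi> \<in> fock.span (tensor ` lists ?X)" using B(2) by blast
  moreover have "0 \<notin> ?X" by (auto simp: zero_prod_def)
  moreover have "pairwise (\<lambda>x y. cinner x y = 0) ?X"
    using C(2) by (auto simp: pairwise_def orthogonal_def cinner_def complex_eq_iff)
  ultimately show ?thesis by (rule that)
qed

lemma prod_pos_complex:
  fixes f :: "'b \<Rightarrow> complex"
  assumes "\<And>i. i \<in> A \<Longrightarrow> 0 < f i"
  shows "0 < prod f A"
  using assms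
  by (induction A rule: infinite_finite_induct) (auto simp: less_complex_def)

text \<open>Distinct words over orthogonal nonzero vectors are orthogonal and have positive norm.
  The form is diagonal in them, with nonnegative terms, and a nonzero coefficient gives a positive
  one.\<close>

lemma fock_inner_pos:
  fixes \<xi> :: "'a::real_inner fock"
  assumes "\<xi> \<noteq> 0"
  shows "0 < fock_inner \<xi> \<xi>"
proof -
  obtain X :: "'a complexified set" where X: "\<xi> \<in> fock.span (tensor ` lists X)" "0 \<notin> X"
    "pairwise (\<lambda>x y. cinner x y = 0) X"
    by (rule fock_span_orthogonal_words)
  have pos: "0 < fock_inner b b" if "b \<in> tensor ` lists X" for b
    using that X(2)
    by (auto simp: fock_inner_tensor intro!: prod_pos_complex cplx.ip_pos dest!: nth_mem)
  have orth: "fock_inner b b' = 0"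
    if b: "b \<in> tensor ` lists X" "b' \<in> tensor ` lists X" "b \<noteq> b'" for b b'
  proof -
    obtain g h where gh: "b = tensor g" "b' = tensor h" "set g \<subseteq> X" "set h \<subseteq> X" "g \<noteq> h"
      using b by auto
    show ?thesis
    proof (cases "length g = length h")
      case True
      then obtain i where i: "i < length g" "g ! i \<noteq> h ! i"
        using gh(5) by (auto simp: list_eq_iff_nth_eq)
      have "g ! i \<in> X" "h ! i \<in> X" using gh(3,4) i True by (auto dest: nth_mem)
      then have "cinner (g ! i) (h ! i) = 0" using X(3) i by (auto simp: pairwise_def)
      then show ?thesis using gh True i by (auto simp: fock_inner_tensor intro!: prod_zero)
    qed (simp add: gh fock_inner_tensor)
  qed
  obtain T r where T: "finite T" "T \<subseteq> tensor ` lists X" "\<xi> = (\<Sum>a\<in>T. fock_scale (r a) a)"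
    using X(1) unfolding fock.span_explicit by blast
  have "fock_inner \<xi> \<xi> = (\<Sum>a\<in>T. \<Sum>b\<in>T. cnj (r a) * r b * fock_inner a b)"
    unfolding T(3)
    by (subst sum.swap)
      (simp add: fock_inner_sum_left fock_inner_sum_right fock_inner_scale_left
        fock_inner_scale_right sum_distrib_left mult_ac)
  also have "\<dots> = (\<Sum>a\<in>T. \<Sum>b\<in>T. if a = b then cnj (r a) * r a * fock_inner a a else 0)"
    using orth T(2) by (intro sum.cong refl) (auto simp: subset_iff)
  also have "\<dots> = (\<Sum>a\<in>T. cnj (r a) * r a * fock_inner a a)"
    using T(1) by simp
  finally have eq: "fock_inner \<xi> \<xi> = (\<Sum>a\<in>T. cnj (r a) * r a * fock_inner a a)" .
  have "\<exists>a\<in>T. r a \<noteq> 0"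
  proof (rule ccontr)
    assume "\<not> (\<exists>a\<in>T. r a \<noteq> 0)"
    then have "\<xi> = 0" unfolding T(3) by (intro sum.neutral) simp
    with assms show False by simp
  qed
  then obtain a where a: "a \<in> T" "r a \<noteq> 0" by blast
  have sq: "cnj z * z = complex_of_real ((cmod z)\<^sup>2)" for z
    using complex_norm_square[of z] by (simp add: mult.commute)
  have "0 \<le> cnj (r b) * r b * fock_inner b b" if "b \<in> T" for b
    using pos[of b] that T(2) unfolding sq
    by (auto simp: less_complex_def less_eq_complex_def subset_iff)
  moreover have "0 < cnj (r a) * r a * fock_inner a a"
    using pos[of a] a T(2) unfolding sq by (auto simp: less_complex_def subset_iff)
  ultimately have "0 < (\<Sum>a\<in>T. cnj (r a) * r a * fock_inner a a)"
    using a(1) T(1) by (intro sum_pos2[of T a]) auto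
  then show ?thesis unfolding eq .
qed

lemma fock_inner_self_nonneg: "0 \<le> fock_inner \<xi> \<xi>"
  using fock_inner_pos[of \<xi>] by (cases "\<xi> = 0") auto

text \<open>Elementary tensors span. The scaling \<open>s\<close> is a parameter so that the rule
  covers linear and conjugate-linear maps.\<close>

lemma fock_linear_eqI:
  assumes "\<And>h. F (tensor h) = G (tensor h)"
    and "\<And>\<xi> \<eta>. F (\<xi> + \<eta>) = F \<xi> + F \<eta>" "\<And>\<xi> \<eta>. G (\<xi> + \<eta>) = G \<xi> + G \<eta>"
    and "\<And>c \<xi>. F (fock_scale c \<xi>) = s c (F \<xi>)" "\<And>c \<xi>. G (fock_scale c \<xi>) = s c (G \<xi>)"
  shows "F \<xi> = (G \<xi> :: 'c::ab_group_add)"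
  using UNIV_I[of \<xi>] unfolding fock_span_tensor[symmetric]
proof (induction rule: fock.span_induct_alt)
  case base
  show ?case using assms(2)[of 0 0] assms(3)[of 0 0] by simp
next
  case (step c \<xi> \<eta>)
  then show ?case using assms by auto
qed


section \<open>Permutation operators\<close>

lemma perm_op_zero [simp]: "perm_op n \<sigma> 0 = 0"
  using perm_op_add[of n \<sigma> 0 0] by simp

text \<open>The order reverses because permutations act on positions: slot \<open>i\<close> of
  \<open>permute_list \<sigma> h\<close> is \<open>h ! \<sigma> i\<close>.\<close>

lemma perm_op_compose:
  fixes \<xi> :: "'a::real_inner fock"
  assumes "\<sigma> permutes {..<n}" "\<tau> permutes {..<n}"
  shows "perm_op n \<sigma> (perm_op n \<tau> \<xi>) = perm_op n (\<tau> \<circ> \<sigma>) \<xi>"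
proof (rule fock_linear_eqI[where F = "\<lambda>\<xi>. perm_op n \<sigma> (perm_op n \<tau> \<xi>)" and s = fock_scale])
  fix h :: "'a complexified list"
  show "perm_op n \<sigma> (perm_op n \<tau> (tensor h)) = perm_op n (\<tau> \<circ> \<sigma>) (tensor h)"
    using assms permutes_compose[OF assms]
    by (auto simp: perm_op_tensor permute_list_compose)
qed (simp_all add: perm_op_add perm_op_scale)

text \<open>Reindexing the product of slotwise inner products by \<open>inv \<sigma>\<close> moves
  the permutation to the other argument. Unless both words have length \<open>n\<close>, both sides
  vanish.\<close>

lemma fock_inner_perm_op_tensor:
  assumes "\<sigma> permutes {..<n}"
  shows "fock_inner (perm_op n \<sigma> (tensor g)) (tensor h)
    = fock_inner (tensor g) (perm_op n (inv \<sigma>) (tensor h))"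
proof (cases "length g = n \<and> length h = n")
  case True
  have inv: "inv \<sigma> permutes {..<n}" using assms by (rule permutes_inv)
  have "(\<Prod>i<n. cinner (permute_list \<sigma> g ! i) (h ! i)) = (\<Prod>i<n. cinner (g ! \<sigma> i) (h ! i))"
    using True assms by (intro prod.cong) (auto simp: permute_list_nth)
  also have "\<dots> = (\<Prod>i<n. cinner (g ! \<sigma> (inv \<sigma> i)) (h ! inv \<sigma> i))"
    using prod.permute[OF inv, of "\<lambda>i. cinner (g ! \<sigma> i) (h ! i)"] by (simp add: o_def)
  also have "\<dots> = (\<Prod>i<n. cinner (g ! i) (permute_list (inv \<sigma>) h ! i))"
    using True inv assms by (intro prod.cong) (auto simp: permute_list_nth permutes_inverses)
  finally show ?thesis using True assms inv by (simp add: perm_op_tensor fock_inner_tensor)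
next
  case False
  then show ?thesis using assms permutes_inv[OF assms]
    by (auto simp: perm_op_tensor fock_inner_tensor)
qed

lemma fock_inner_perm_op:
  fixes \<eta> \<xi> :: "'a::real_inner fock"
  assumes "\<sigma> permutes {..<n}"
  shows "fock_inner (perm_op n \<sigma> \<eta>) \<xi> = fock_inner \<eta> (perm_op n (inv \<sigma>) \<xi>)"
proof (rule fock_linear_eqI[where \<xi> = \<eta> and F = "\<lambda>\<eta>. fock_inner (perm_op n \<sigma> \<eta>) \<xi>"
      and s = "\<lambda>c. (*) (cnj c)"])
  fix g :: "'a complexified list"
  show "fock_inner (perm_op n \<sigma> (tensor g)) \<xi> = fock_inner (tensor g) (perm_op n (inv \<sigma>) \<xi>)"
    by (rule fock_linear_eqI[where \<xi> = \<xi> and F = "fock_inner (perm_op n \<sigma> (tensor g))" and s = "(*)"])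
      (simp_all add: fock_inner_perm_op_tensor assms fock_inner_add_right fock_inner_scale_right
        perm_op_add perm_op_scale)
qed (simp_all add: fock_inner_add_left fock_inner_scale_left perm_op_add perm_op_scale)

text \<open>Extended by 0 to the other degrees, \<open>perm_op n id\<close> is the projection onto
  degree \<open>n\<close>.\<close>

lemma perm_op_id_tensor_power:
  assumes "\<xi> \<in> tensor_power n"
  shows "perm_op n id \<xi> = \<xi>"
  using assms unfolding tensor_power_def
proof (induction rule: fock.span_induct_alt)
  case base
  show ?case by simp
next
  case (step c \<xi> \<eta>)
  then obtain h where h: "\<xi> = tensor h" "length h = n" by auto
  have "perm_op n id (tensor h) = tensor h"
    using perm_op_tensor[OF permutes_id, of n h] h(2) by simp
  then show ?case using step(2) h(1) by (simp only: perm_op_add perm_op_scale)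
qed

text \<open>A word pairs only with the component of its own degree, here 0, so \<xi> is orthogonal
  to all words and hence to itself.\<close>

lemma fock_eq_0_if_perm_op_id_eq_0:
  assumes "\<And>n. perm_op n id \<xi> = 0"
  shows "\<xi> = 0"
proof -
  have "fock_inner (tensor h) \<xi> = 0" for h
    using fock_inner_perm_op[of id "length h" "tensor h" \<xi>] assms
    by (simp add: perm_op_tensor permutes_id)
  then have "fock_inner \<xi> \<xi> = 0"
    by (intro fock_linear_eqI[where \<xi> = \<xi> and F = "\<lambda>\<eta>. fock_inner \<eta> \<xi>" and G = "\<lambda>_. 0"
          and s = "\<lambda>c. (*) (cnj c)"])
      (simp_all add: fock_inner_add_left fock_inner_scale_left)
  then show ?thesis using fock_inner_pos[of \<xi>] by auto
qed


section \<open>Diagonalising the weights\<close>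

definition index_pairs :: "nat \<Rightarrow> (nat \<times> nat) set" where
  "index_pairs n = {(i, j). i < j \<and> j < n}"

lemma finite_index_pairs [simp]: "finite (index_pairs n)"
  by (rule finite_subset[of _ "{..<n} \<times> {..<n}"]) (auto simp: index_pairs_def)

definition order_sign :: "(nat \<Rightarrow> nat) \<Rightarrow> nat \<times> nat \<Rightarrow> real" where
  "order_sign \<sigma> e = (if \<sigma> (fst e) < \<sigma> (snd e) then 1 else -1)"

text \<open>For a permutation \<sigma> and \<open>S \<subseteq> index_pairs n\<close> this is -1 to
  the number of inversions of \<sigma> in \<open>S\<close>: a character of the group of subsets,
  evaluated at the inversion set.\<close>

definition character :: "(nat \<times> nat) set \<Rightarrow> (nat \<Rightarrow> nat) \<Rightarrow> real" where
  "character S \<sigma> = (\<Prod>e\<in>S. order_sign \<sigma> e)"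

text \<open>The coefficient \<open>c\<^sub>S\<close> of the opening text. The halves come from the
  squared length 2 of the eigenvectors (1, 1) and (1, -1).\<close>

definition eigenvalue :: "real \<Rightarrow> real \<Rightarrow> nat \<Rightarrow> (nat \<times> nat) set \<Rightarrow> real" where
  "eigenvalue q t n S = ((t + q) / 2) ^ card (index_pairs n - S) * ((t - q) / 2) ^ card S"

text \<open>The assumption on \<open>q\<close> and \<open>t\<close> enters here: it makes both
  \<open>t + q\<close> and \<open>t - q\<close> positive.\<close>

lemma eigenvalue_pos: "\<bar>q\<bar> < t \<Longrightarrow> 0 < eigenvalue q t n S"
  by (auto simp: eigenvalue_def)

text \<open>By injectivity each pair is either an inversion or a co-inversion, so the exponents
  count the factors.\<close>

lemma weight_eq_prod:
  assumes "\<pi> permutes {..<n}"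
  shows "q ^ inversions n \<pi> * t ^ coinversions n \<pi>
    = (\<Prod>(i, j)\<in>index_pairs n. if \<pi> i < \<pi> j then t else q)"
proof -
  have "\<pi> i \<noteq> \<pi> j" if "i < j" for i j
    using permutes_inj[OF assms] that by (metis injD nat_neq_iff)
  then have i: "{(i, j). i < j \<and> j < n \<and> \<pi> i > \<pi> j} = {e \<in> index_pairs n. \<not> \<pi> (fst e) < \<pi> (snd e)}"
    by (force simp: index_pairs_def)
  have c: "{(i, j). i < j \<and> j < n \<and> \<pi> i < \<pi> j} = {e \<in> index_pairs n. \<pi> (fst e) < \<pi> (snd e)}"
    by (auto simp: index_pairs_def)
  have "(\<Prod>(i, j)\<in>index_pairs n. if \<pi> i < \<pi> j then t else q)
      = (\<Prod>e\<in>index_pairs n. if \<pi> (fst e) < \<pi> (snd e) then t else q)"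
    by (intro prod.cong) auto
  also have "\<dots> = t ^ coinversions n \<pi> * q ^ inversions n \<pi>"
    unfolding inversions_def coinversions_def i c
    by (subst prod.If_cases) (auto simp: Int_def)
  finally show ?thesis by (simp only: mult.commute)
qed

text \<open>The induced action on two-element sets, each stored in increasing order;
  \<open>inv \<sigma>\<close> induces the inverse map.\<close>

lemma bij_betw_index_pairs:
  assumes "\<sigma> permutes {..<n}"
  shows "bij_betw (\<lambda>(a, b). (min (\<sigma> a) (\<sigma> b), max (\<sigma> a) (\<sigma> b))) (index_pairs n) (index_pairs n)"
proof -
  have lt: "\<pi> a < n" if "\<pi> permutes {..<n}" "a < n" for \<pi> a
    using that by (metis lessThan_iff permutes_in_image)
  have ne: "\<pi> a \<noteq> \<pi> b" if "\<pi> permutes {..<n}" "a < b" for \<pi> and a b :: nat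
    using that by (metis injD nat_neq_iff permutes_inj)
  have mem: "(min (\<pi> a) (\<pi> b), max (\<pi> a) (\<pi> b)) \<in> index_pairs n"
    if "\<pi> permutes {..<n}" "(a, b) \<in> index_pairs n" for \<pi> a b
    using that lt[of \<pi> a] lt[of \<pi> b] ne[of \<pi> a b] by (auto simp: index_pairs_def min_def max_def)
  show ?thesis
    by (rule bij_betw_byWitness[where f' = "\<lambda>(a, b). (min (inv \<sigma> a) (inv \<sigma> b), max (inv \<sigma> a) (inv \<sigma> b))"])
      (use mem[OF assms] mem[OF permutes_inv[OF assms]] permutes_inverses[OF assms] in
        \<open>auto simp: min_def max_def index_pairs_def\<close>)
qed

lemma weight_compose_inv:
  assumes "\<sigma> permutes {..<n}" "\<tau> permutes {..<n}"
  shows "q ^ inversions n (\<tau> \<circ> inv \<sigma>) * t ^ coinversions n (\<tau> \<circ> inv \<sigma>)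
    = (\<Sum>S\<in>Pow (index_pairs n). eigenvalue q t n S * (character S \<sigma> * character S \<tau>))"
proof -
  let ?E = "index_pairs n" and ?\<pi> = "\<tau> \<circ> inv \<sigma>"
  have ne: "\<sigma> a \<noteq> \<sigma> b" "\<tau> a \<noteq> \<tau> b" if "a < b" for a b
    using that assms by (metis injD nat_neq_iff permutes_inj)+
  have "?\<pi> permutes {..<n}" using assms by (intro permutes_compose permutes_inv)
  then have "q ^ inversions n ?\<pi> * t ^ coinversions n ?\<pi>
      = (\<Prod>(i, j)\<in>?E. if ?\<pi> i < ?\<pi> j then t else q)"
    by (rule weight_eq_prod)
  \<comment> \<open>Each pair is the sorted image under \<sigma> of some (a, b), and
    \<open>?\<pi>\<close> keeps its order iff \<sigma> and \<tau> order a and b alike.\<close>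
  also have "\<dots> = (\<Prod>e\<in>?E. case (case e of (a, b) \<Rightarrow> (min (\<sigma> a) (\<sigma> b), max (\<sigma> a) (\<sigma> b))) of
      (i, j) \<Rightarrow> if ?\<pi> i < ?\<pi> j then t else q)"
    by (rule prod.reindex_bij_betw[OF bij_betw_index_pairs[OF assms(1)], symmetric])
  \<comment> \<open>The affine function of the sign product with value \<open>t\<close> at 1 and
    \<open>q\<close> at -1.\<close>
  also have "\<dots> = (\<Prod>e\<in>?E. (t - q) / 2 * (order_sign \<sigma> e * order_sign \<tau> e) + (t + q) / 2)"
  proof (intro prod.cong refl)
    fix e assume "e \<in> ?E"
    then obtain a b where e: "e = (a, b)" and "a < b" by (auto simp: index_pairs_def)
    then show "(case (case e of (a, b) \<Rightarrow> (min (\<sigma> a) (\<sigma> b), max (\<sigma> a) (\<sigma> b))) of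
        (i, j) \<Rightarrow> if ?\<pi> i < ?\<pi> j then t else q)
        = (t - q) / 2 * (order_sign \<sigma> e * order_sign \<tau> e) + (t + q) / 2"
      using ne[of a b] permutes_inverses(2)[OF assms(1)]
      by (auto simp: order_sign_def min_def max_def field_simps)
  qed
  \<comment> \<open>Expand the product: \<open>S\<close> collects the pairs that contribute their
    sign term.\<close>
  also have "\<dots> = (\<Sum>S\<in>Pow ?E. (\<Prod>e\<in>S. (t - q) / 2 * (order_sign \<sigma> e * order_sign \<tau> e))
      * (\<Prod>e\<in>?E - S. (t + q) / 2))"
    by (rule prod_add) simp
  also have "\<dots> = (\<Sum>S\<in>Pow ?E. eigenvalue q t n S * (character S \<sigma> * character S \<tau>))"
    by (intro sum.cong refl)
      (simp only: prod.distrib prod_constant eigenvalue_def character_def mult_ac)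
  finally show ?thesis .
qed

text \<open>Monotonicity below \<open>n\<close> and fixed points from \<open>n\<close> on give
  \<open>i \<le> \<sigma> i\<close> by induction; a permutation that moves no point down is the
  identity.\<close>

lemma permutes_lessThan_eq_id:
  fixes n :: nat
  assumes "\<sigma> permutes {..<n}" "\<And>i j. i < j \<Longrightarrow> j < n \<Longrightarrow> \<sigma> i < \<sigma> j"
  shows "\<sigma> = id"
proof -
  have "i \<le> \<sigma> i" for i
  proof (induction i)
    case (Suc i)
    show ?case
    proof (cases "Suc i < n")
      case True
      then show ?thesis using Suc assms(2)[of i "Suc i"] by simp
    qed (use assms(1) in \<open>auto simp: permutes_def\<close>)
  qed simp
  then show ?thesis using permutes_natset_ge[OF assms(1)] by blast
qed

text \<open>The sum factors over the pairs into \<open>order_sign \<sigma> e + 1\<close>. An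
  inversion, which every permutation but the identity has, makes a factor 0.\<close>

lemma sum_character:
  assumes "\<sigma> permutes {..<n}"
  shows "(\<Sum>S\<in>Pow (index_pairs n). character S \<sigma>) = (if \<sigma> = id then 2 ^ card (index_pairs n) else 0)"
proof -
  have *: "(\<Sum>S\<in>Pow (index_pairs n). character S \<sigma>) = (\<Prod>e\<in>index_pairs n. order_sign \<sigma> e + 1)"
    by (simp add: prod_add character_def)
  show ?thesis
  proof (cases "\<sigma> = id")
    case True
    have "(\<Prod>e\<in>index_pairs n. order_sign id e + 1) = (\<Prod>e\<in>index_pairs n. 2)"
      by (intro prod.cong refl) (auto simp: order_sign_def index_pairs_def)
    with * True show ?thesis by simp
  next
    case False
    then obtain i j where "i < j" "j < n" "\<not> \<sigma> i < \<sigma> j"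
      using permutes_lessThan_eq_id[OF assms] by blast
    then have "(i, j) \<in> index_pairs n" "order_sign \<sigma> (i, j) + 1 = 0"
      by (auto simp: index_pairs_def order_sign_def)
    then have "(\<Prod>e\<in>index_pairs n. order_sign \<sigma> e + 1) = 0"
      by (intro prod_zero) auto
    with * False show ?thesis by simp
  qed
qed


section \<open>The deformed form\<close>

definition character_op :: "nat \<Rightarrow> (nat \<times> nat) set \<Rightarrow> 'a::real_inner fock \<Rightarrow> 'a fock" where
  "character_op n S \<xi> =
     (\<Sum>\<sigma> | \<sigma> permutes {..<n}. fock_scale (complex_of_real (character S \<sigma>)) (perm_op n \<sigma> \<xi>))"

text \<open>Ensures that the \<open>character_op n S\<close> do not all annihilate a vector with
  nonzero component in degree \<open>n\<close>.\<close>

lemma sum_character_op: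
  "(\<Sum>S\<in>Pow (index_pairs n). character_op n S \<xi>)
    = fock_scale (2 ^ card (index_pairs n)) (perm_op n id \<xi>)"
proof -
  let ?E = "index_pairs n" and ?N = "2 ^ card (index_pairs n) :: complex"
  have "(\<Sum>S\<in>Pow ?E. character_op n S \<xi>) = (\<Sum>\<sigma> | \<sigma> permutes {..<n}.
      fock_scale (complex_of_real (\<Sum>S\<in>Pow ?E. character S \<sigma>)) (perm_op n \<sigma> \<xi>))"
    unfolding character_op_def by (subst sum.swap) (simp add: fock.scale_sum_left)
  also have "\<dots> = (\<Sum>\<sigma> | \<sigma> permutes {..<n}.
      if \<sigma> = id then fock_scale ?N (perm_op n id \<xi>) else 0)"
    by (intro sum.cong refl) (simp add: sum_character del: of_real_sum)
  also have "\<dots> = fock_scale ?N (perm_op n id \<xi>)"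
    by (simp add: finite_permutations permutes_id)
  finally show ?thesis .
qed

lemma fock_inner_qt_op_deg:
  "fact n * fock_inner \<eta> (qt_op_deg q t n \<xi>) = (\<Sum>S\<in>Pow (index_pairs n).
     complex_of_real (eigenvalue q t n S) * fock_inner (character_op n S \<eta>) (character_op n S \<xi>))"
proof -
  let ?G = "{\<pi>. \<pi> permutes {..<n}}" and ?E = "index_pairs n"
  let ?w = "\<lambda>\<pi>. complex_of_real (q ^ inversions n \<pi> * t ^ coinversions n \<pi>)"
  have deg: "fock_inner \<eta> (qt_op_deg q t n \<xi>) = (\<Sum>\<pi>\<in>?G. ?w \<pi> * fock_inner \<eta> (perm_op n \<pi> \<xi>))"
    by (simp add: qt_op_deg_def fock_inner_sum_right fock_inner_scale_right)
  \<comment> \<open>Substitute \<open>\<tau> \<circ> inv \<sigma>\<close> for the summation variable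
    and move \<open>inv \<sigma>\<close> to the left argument as an adjoint. This works for every
    \<sigma>, so one may sum over all \<open>fact n\<close> of them.\<close>
  have translate: "fock_inner \<eta> (qt_op_deg q t n \<xi>) =
      (\<Sum>\<tau>\<in>?G. ?w (\<tau> \<circ> inv \<sigma>) * fock_inner (perm_op n \<sigma> \<eta>) (perm_op n \<tau> \<xi>))"
    if \<sigma>: "\<sigma> permutes {..<n}" for \<sigma>
    unfolding deg
    by (subst sum_permutations_compose_right[OF permutes_inv[OF \<sigma>]])
      (intro sum.cong refl, simp add: fock_inner_perm_op \<sigma> perm_op_compose permutes_inv)
  have "fact n * fock_inner \<eta> (qt_op_deg q t n \<xi>)
      = (\<Sum>\<sigma>\<in>?G. fock_inner \<eta> (qt_op_deg q t n \<xi>))"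
    by (simp add: card_permutations[of _ n])
  also have "\<dots> = (\<Sum>\<sigma>\<in>?G. \<Sum>\<tau>\<in>?G. ?w (\<tau> \<circ> inv \<sigma>) *
      fock_inner (perm_op n \<sigma> \<eta>) (perm_op n \<tau> \<xi>))"
    by (intro sum.cong refl translate) simp
  also have "\<dots> = (\<Sum>\<sigma>\<in>?G. \<Sum>\<tau>\<in>?G. \<Sum>S\<in>Pow ?E.
      complex_of_real (eigenvalue q t n S * (character S \<sigma> * character S \<tau>)) *
      fock_inner (perm_op n \<sigma> \<eta>) (perm_op n \<tau> \<xi>))"
    by (intro sum.cong refl)
      (simp only: weight_compose_inv mem_Collect_eq of_real_sum sum_distrib_right)
  also have "\<dots> = (\<Sum>\<sigma>\<in>?G. \<Sum>S\<in>Pow ?E. \<Sum>\<tau>\<in>?G.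
      complex_of_real (eigenvalue q t n S * (character S \<sigma> * character S \<tau>)) *
      fock_inner (perm_op n \<sigma> \<eta>) (perm_op n \<tau> \<xi>))"
    by (intro sum.cong refl sum.swap)
  also have "\<dots> = (\<Sum>S\<in>Pow ?E. \<Sum>\<sigma>\<in>?G. \<Sum>\<tau>\<in>?G.
      complex_of_real (eigenvalue q t n S * (character S \<sigma> * character S \<tau>)) *
      fock_inner (perm_op n \<sigma> \<eta>) (perm_op n \<tau> \<xi>))"
    by (rule sum.swap)
  \<comment> \<open>For fixed \<open>S\<close> the weight splits into real factors in \<sigma> and
    in \<tau>, so the double sum is a single pairing.\<close>
  also have "\<dots> = (\<Sum>S\<in>Pow ?E.
      complex_of_real (eigenvalue q t n S) * fock_inner (character_op n S \<eta>) (character_op n S \<xi>))"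
    by (intro sum.cong refl, subst sum.swap)
      (simp add: character_op_def fock_inner_sum_left fock_inner_sum_right fock_inner_scale_left
        fock_inner_scale_right sum_distrib_left mult_ac)
  finally show ?thesis .
qed

text \<open>The diagonal form shows the symmetry: its coefficients are real and the full Fock space
  form is Hermitian.\<close>

lemma fock_inner_qt_op_deg_cnj:
  "fock_inner \<xi> (qt_op_deg q t n \<eta>) = cnj (fock_inner \<eta> (qt_op_deg q t n \<xi>))"
proof -
  have "fact n * fock_inner \<xi> (qt_op_deg q t n \<eta>)
      = cnj (fact n * fock_inner \<eta> (qt_op_deg q t n \<xi>))"
    unfolding fock_inner_qt_op_deg cnj_sum
    by (intro sum.cong refl) (simp add: fock_inner_cnj[symmetric])
  then show ?thesis by simp
qed

text \<open>Assuming only a nonzero component in degree \<open>n\<close> lets this serve single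
  tensor powers and the whole Fock space alike.\<close>

lemma fock_inner_qt_op_deg_pos:
  assumes "\<bar>q\<bar> < t" "perm_op n id \<xi> \<noteq> 0"
  shows "0 < fock_inner \<xi> (qt_op_deg q t n \<xi>)"
proof -
  let ?f = "\<lambda>S. complex_of_real (eigenvalue q t n S) *
    fock_inner (character_op n S \<xi>) (character_op n S \<xi>)"
  have "(\<Sum>S\<in>Pow (index_pairs n). character_op n S \<xi>) \<noteq> 0"
    using assms(2) by (simp add: sum_character_op)
  then obtain S where S: "S \<in> Pow (index_pairs n)" "character_op n S \<xi> \<noteq> 0"
    by (meson sum.neutral)
  have "0 \<le> ?f S'" for S'
    using fock_inner_self_nonneg[of "character_op n S' \<xi>"] eigenvalue_pos[OF assms(1), of n S']
    by (simp add: less_eq_complex_def)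
  moreover have "0 < ?f S"
    using fock_inner_pos[OF S(2)] eigenvalue_pos[OF assms(1), of n S]
    by (simp add: less_complex_def)
  ultimately have "0 < sum ?f (Pow (index_pairs n))"
    using S(1) by (intro sum_pos2[of _ S]) auto
  then have "0 < complex_of_real (fact n) * fock_inner \<xi> (qt_op_deg q t n \<xi>)"
    by (simp add: fock_inner_qt_op_deg)
  then show ?thesis by (simp add: less_complex_def zero_less_mult_iff)
qed

section \<open>Assembling the degrees\<close>

text \<open>Consequently a degree in which \<xi> has zero component contributes nothing to the
  form.\<close>

lemma qt_op_deg_perm_op_id: "qt_op_deg q t n (perm_op n id \<xi>) = qt_op_deg q t n \<xi>"
  unfolding qt_op_deg_def by (intro sum.cong refl) (simp add: perm_op_compose permutes_id)

text \<open>\<open>N\<close> may exceed the support, so that several vectors can share one index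
  set.\<close>

lemma qt_inner_eq_sum:
  assumes "finite N" "{n. qt_op_deg q t n \<xi> \<noteq> 0} \<subseteq> N"
  shows "qt_inner q t \<eta> \<xi> = (\<Sum>n\<in>N. fock_inner \<eta> (qt_op_deg q t n \<xi>))"
  unfolding qt_inner_def qt_op_def
  by (simp add: Sum_any.expand_superset[OF assms] fock_inner_sum_right)

lemma qt_inner_add_right: "qt_inner q t \<eta> (\<xi> + \<zeta>) = qt_inner q t \<eta> \<xi> + qt_inner q t \<eta> \<zeta>"
proof -
  let ?N = "{n. qt_op_deg q t n \<xi> \<noteq> 0} \<union> {n. qt_op_deg q t n \<zeta> \<noteq> 0}"
  have "finite ?N" by (simp add: finite_qt_op_deg)
  then show ?thesis
    by (subst (1 2 3) qt_inner_eq_sum[of ?N])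
      (auto simp: qt_op_deg_add fock_inner_add_right sum.distrib)
qed

lemma qt_inner_scale_right: "qt_inner q t \<eta> (fock_scale c \<xi>) = c * qt_inner q t \<eta> \<xi>"
proof -
  let ?N = "{n. qt_op_deg q t n \<xi> \<noteq> 0}"
  have "finite ?N" by (simp add: finite_qt_op_deg)
  then show ?thesis
    by (subst (1 2) qt_inner_eq_sum[of ?N])
      (auto simp: qt_op_deg_scale fock_inner_scale_right sum_distrib_left)
qed

lemma qt_inner_cnj: "qt_inner q t \<xi> \<eta> = cnj (qt_inner q t \<eta> \<xi>)"
proof -
  let ?N = "{n. qt_op_deg q t n \<xi> \<noteq> 0} \<union> {n. qt_op_deg q t n \<eta> \<noteq> 0}"
  have "finite ?N" by (simp add: finite_qt_op_deg)
  then show ?thesis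
    by (subst (1 2) qt_inner_eq_sum[of ?N])
      (auto simp: fock_inner_qt_op_deg_cnj[of \<xi>] intro!: sum.cong)
qed

lemma qt_inner_pos:
  assumes "\<bar>q\<bar> < t" "\<xi> \<noteq> 0"
  shows "0 < qt_inner q t \<xi> \<xi>"
proof -
  let ?N = "{n. qt_op_deg q t n \<xi> \<noteq> 0}"
  obtain m where m: "perm_op m id \<xi> \<noteq> 0"
    using fock_eq_0_if_perm_op_id_eq_0 assms(2) by blast
  have pos: "0 < fock_inner \<xi> (qt_op_deg q t n \<xi>)" if "perm_op n id \<xi> \<noteq> 0" for n
    using that by (rule fock_inner_qt_op_deg_pos[OF assms(1)])
  have "0 \<le> fock_inner \<xi> (qt_op_deg q t n \<xi>)" for n
    using pos[of n] qt_op_deg_perm_op_id[of q t n \<xi>] by (cases "perm_op n id \<xi> = 0") auto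
  \<comment> \<open>A positive pairing forces \<open>qt_op_deg q t m \<xi>\<close> to be
    nonzero.\<close>
  moreover have "m \<in> ?N" using pos[OF m] by auto
  ultimately have "0 < (\<Sum>n\<in>?N. fock_inner \<xi> (qt_op_deg q t n \<xi>))"
    using pos[OF m] by (intro sum_pos2[of _ m]) (auto simp: finite_qt_op_deg)
  then show ?thesis by (simp add: qt_inner_eq_sum[of ?N] finite_qt_op_deg)
qed

theorem mainTheorem1:
  fixes q t :: real
  assumes "\<bar>q\<bar> < t"
  shows "(\<forall>n. \<forall>\<xi> \<in> (tensor_power n :: 'a::{real_inner, polish_space} fock set).
            \<xi> \<noteq> 0 \<longrightarrow> 0 < fock_inner \<xi> (qt_op_deg q t n \<xi>))
       \<and> complex_inner_product (fock_scale :: complex \<Rightarrow> 'a fock \<Rightarrow> 'a fock) (qt_inner q t)"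
proof (intro conjI allI ballI impI)
  fix n and \<xi> :: "'a fock"
  assume "\<xi> \<in> tensor_power n" "\<xi> \<noteq> 0"
  then show "0 < fock_inner \<xi> (qt_op_deg q t n \<xi>)"
    using fock_inner_qt_op_deg_pos[OF assms, of n \<xi>] by (simp add: perm_op_id_tensor_power)
next
  show "complex_inner_product (fock_scale :: complex \<Rightarrow> 'a fock \<Rightarrow> 'a fock) (qt_inner q t)"
  proof
    \<comment> \<open>The laws in the left argument follow from those in the right by Hermitian
      symmetry.\<close>
    fix x y z :: "'a fock" and c :: complex
    show "qt_inner q t (x + y) z = qt_inner q t x z + qt_inner q t y z"
      by (metis qt_inner_cnj qt_inner_add_right complex_cnj_add)
    show "qt_inner q t (fock_scale c x) z = cnj c * qt_inner q t x z"
      by (metis qt_inner_cnj qt_inner_scale_right complex_cnj_mult)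
  qed (rule qt_inner_add_right qt_inner_scale_right qt_inner_cnj qt_inner_pos[OF assms], assumption?)+
qed

end
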